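(* Let $s$ be a $\mathbb C^{p\times q}$-valued Schur multiplier (of the Drury-Arveson space on $\mathbb B_N$) and let $\nu\in\mathbb B_N$. Let $\xi\in\mathbb C^p$ and $\eta\in\mathbb C^q$ be such that $\eta^*\eta<\xi^*\xi$ and $\xi^*s(\nu)=\eta^*$. Put $c=\begin{pmatrix}\xi\\ \eta\end{pmatrix}$ and $J_{p,q}=\begin{pmatrix}I_p&0\\0&-I_q\end{pmatrix}$, so that $c^*J_{p,q}c=\xi^*\xi-\eta^*\eta$. Then, for all $\lambda\in\mathbb B_N$, $$\left\|(\xi^*s(\lambda)-\eta^* )\left(I_q+\frac{\eta\eta^*}{c^*J_{p,q}c}\right)^{1/2}\right\|\le\frac{|\xi^*\xi-\xi^*s(\lambda)\eta|}{\sqrt{c^*J_{p,q}c}}\cdot\|b_\nu(\lambda)\|.$$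
   Context: $N,p,q$ are positive integers. $\mathbb B_N$ is the open unit ball of $\mathbb C^N$ (row vectors), with $\langle\lambda,\mu\rangle=\lambda\mu^*$. Vectors $\xi,\eta$ are columns; $\|\cdot\|$ is the Euclidean norm of row vectors. A $\mathbb C^{p\times q}$-valued Schur multiplier is a function $s:\mathbb B_N\to\mathbb C^{p\times q}$ such that the kernel $\frac{I_p-s(\lambda)s(\mu)^*}{1-\langle\lambda,\mu\rangle}$ is positive (semidefinite) on $\mathbb B_N$. For $\nu\in\mathbb B_N$ the Blaschke factor is the $\mathbb C^{1\times N}$-valued function $b_\nu(\lambda)=\frac{(1-\langle\nu,\nu\rangle)^{1/2}}{1-\langle\lambda,\nu\rangle}(\lambda-\nu)(I_N-\nu^*\nu)^{-1/2}$. *)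

theory Defs
  imports "HOL-Analysis.Analysis" "HOL-Library.Complex_Order"
begin

text \<open>
  The same type \<^typ>\<open>complex ^ 'n\<close> holds row and column vectors, so the conjugate transpose of a
  vector is its entrywise conjugate.  The order on \<^typ>\<open>complex\<close> is that of
  \<^theory>\<open>HOL-Library.Complex_Order\<close>: \<open>0 \<le> z\<close> says that \<open>z\<close> is real and nonnegative.
\<close>

definition vec_star :: "complex ^ 'n \<Rightarrow> complex ^ 'n"
  where "vec_star x = (\<chi> i. cnj (x $ i))"

definition mat_star :: "complex ^ 'n ^ 'm \<Rightarrow> complex ^ 'm ^ 'n"
  where "mat_star A = (\<chi> i j. cnj (A $ j $ i))"

text \<open>Row times column (a scalar, no conjugation), and column times row (a matrix).\<close>

definition row_col :: "complex ^ 'n \<Rightarrow> complex ^ 'n \<Rightarrow> complex"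
  where "row_col x y = (\<Sum>i\<in>UNIV. x $ i * y $ i)"

definition col_row :: "complex ^ 'm \<Rightarrow> complex ^ 'n \<Rightarrow> complex ^ 'n ^ 'm"
  where "col_row x y = (\<chi> i j. x $ i * y $ j)"

definition row_inner :: "complex ^ 'n \<Rightarrow> complex ^ 'n \<Rightarrow> complex"
  where "row_inner x y = row_col x (vec_star y)"

definition pos_semidef :: "complex ^ 'n ^ 'n \<Rightarrow> bool"
  where "pos_semidef A \<longleftrightarrow> (\<forall>x. 0 \<le> row_col (vec_star x) (A *v x))"

definition mat_sqrt :: "complex ^ 'n ^ 'n \<Rightarrow> complex ^ 'n ^ 'n"
  where "mat_sqrt A = (THE B. pos_semidef B \<and> B ** B = A)"

definition pos_kernel_on :: "'a set \<Rightarrow> ('a \<Rightarrow> 'a \<Rightarrow> complex ^ 'p ^ 'p) \<Rightarrow> bool"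
  where "pos_kernel_on S K \<longleftrightarrow>
    (\<forall>(n::nat) z v. (\<forall>i<n. z i \<in> S) \<longrightarrow>
       0 \<le> (\<Sum>i<n. \<Sum>j<n. row_col (vec_star (v i)) (K (z i) (z j) *v v j)))"

text \<open>The values of \<open>s\<close> outside the unit ball play no role.\<close>

definition schur_multiplier :: "(complex ^ 'n \<Rightarrow> complex ^ 'q ^ 'p) \<Rightarrow> bool"
  where "schur_multiplier s \<longleftrightarrow>
    pos_kernel_on (ball 0 1)
      (\<lambda>l \<mu>. map_matrix (\<lambda>a. a / (1 - row_inner l \<mu>))
                 (mat 1 - s l ** mat_star (s \<mu>)))"

definition blaschke :: "complex ^ 'n \<Rightarrow> complex ^ 'n \<Rightarrow> complex ^ 'n"
  where "blaschke \<nu> l =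
    (csqrt (1 - row_inner \<nu> \<nu>) / (1 - row_inner l \<nu>)) *s
      ((l - \<nu>) v* matrix_inv (mat_sqrt (mat 1 - col_row (vec_star \<nu>) \<nu>)))"

definition stack :: "complex ^ 'p \<Rightarrow> complex ^ 'q \<Rightarrow> complex ^ ('p + 'q)"
  where "stack x y = (\<chi> i. case i of Inl a \<Rightarrow> x $ a | Inr b \<Rightarrow> y $ b)"

definition J_mat :: "complex ^ ('p::finite + 'q::finite) ^ ('p + 'q)"
  where "J_mat = (\<chi> i j. if i = j then (case i of Inl _ \<Rightarrow> 1 | Inr _ \<Rightarrow> - 1) else 0)"

lemma stack_J_stack:
  fixes x :: "complex ^ 'p" and y :: "complex ^ 'q"
  shows "row_col (vec_star (stack x y)) (J_mat *v stack x y)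
       = row_col (vec_star x) x - row_col (vec_star y) y"
proof -
  have J: "(J_mat *v stack x y) $ i = (case i of Inl a \<Rightarrow> x $ a | Inr b \<Rightarrow> - (y $ b))"
    for i :: "'p + 'q"
    by (simp add: matrix_vector_mult_def J_mat_def stack_def if_distrib if_distribR
        sum.delta cong: if_cong split: sum.split)
  have U: "(\<Sum>i\<in>UNIV. g i) = (\<Sum>a\<in>UNIV. g (Inl a)) + (\<Sum>b\<in>UNIV. g (Inr b))"
    for g :: "'p + 'q \<Rightarrow> complex"
    using sum.Plus [of "UNIV :: 'p set" "UNIV :: 'q set" g] by simp
  show ?thesis
    by (simp add: row_col_def U J) (simp add: vec_star_def stack_def sum_negf)
qed

end

theory Submission
  imports Defs
begin

text \<open>
  Compressing the Schur kernel to the direction \<open>\<xi>\<close> gives the scalar positive kernel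
  \<open>(\<xi>\<^sup>*\<xi> - u(\<lambda>) u(\<mu>)\<^sup>*) / (1 - \<langle>\<lambda>,\<mu>\<rangle>)\<close> with \<open>u(\<lambda>) = \<xi>\<^sup>* s(\<lambda>)\<close> and \<open>u(\<nu>) = \<eta>\<^sup>*\<close>.  Put
  \<open>d = \<xi>\<^sup>*\<xi> - \<eta>\<^sup>*\<eta>\<close> and \<open>\<rho> = (1 - \<parallel>\<nu>\<parallel>\<^sup>2)(1 - \<parallel>\<lambda>\<parallel>\<^sup>2) / \<bar>1 - \<langle>\<lambda>,\<nu>\<rangle>\<bar>\<^sup>2\<close>.  Nonnegativity of the
  two-by-two determinant at the points \<open>\<lambda>, \<nu>\<close> reads
  \<open>\<bar>\<xi>\<^sup>*\<xi> - u(\<lambda>)\<eta>\<bar>\<^sup>2 \<rho> \<le> (\<xi>\<^sup>*\<xi> - \<parallel>u(\<lambda>)\<parallel>\<^sup>2) d\<close> (lemma \<open>schur_multiplier_two_point\<close>).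

  The rest is one algebraic identity, \<open>schwarz_pick_identity\<close>: for real \<open>X\<close>, a row \<open>u\<close> and a
  column \<open>y\<close>, with \<open>d = X - y\<^sup>*y\<close>,
  \<open>d \<parallel>u - y\<^sup>*\<parallel>\<^sup>2 + \<bar>(u - y\<^sup>*)y\<bar>\<^sup>2 = \<bar>X - uy\<bar>\<^sup>2 - d (X - \<parallel>u\<parallel>\<^sup>2)\<close>.
  It is used twice.  With \<open>X = \<xi>\<^sup>*\<xi>\<close> and \<open>y = \<eta>\<close> its left-hand side is \<open>d\<close> times the square of the
  norm to be estimated; with \<open>X = 1\<close> and \<open>y = \<nu>\<^sup>*\<close> it yields \<open>\<parallel>b\<^sub>\<nu>(\<lambda>)\<parallel>\<^sup>2 = 1 - \<rho>\<close>.

  The square roots are of matrices \<open>I + t y y\<^sup>*\<close> with \<open>1 + t y\<^sup>*y > 0\<close>.  Such a root is the explicit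
  matrix \<open>I + \<tau> y y\<^sup>*\<close> with \<open>\<tau> = t / (1 + \<surd>(1 + t y\<^sup>*y))\<close>.  It is positive definite and commutes
  with everything that commutes with \<open>I + t y y\<^sup>*\<close>, hence it is the only positive semidefinite root.
\<close>

section \<open>Products of rows and columns\<close>

lemma row_col_add_left: "row_col (x + y) z = row_col x z + row_col y z"
  and row_col_add_right: "row_col z (x + y) = row_col z x + row_col z y"
  and row_col_diff_left: "row_col (x - y) z = row_col x z - row_col y z"
  and row_col_diff_right: "row_col z (x - y) = row_col z x - row_col z y"
  and row_col_scale_left: "row_col (a *s x) z = a * row_col x z"
  and row_col_scale_right: "row_col z (a *s x) = a * row_col z x"
  and row_col_commute: "row_col x z = row_col z x"
  by (simp_all add: row_col_def algebra_simps sum.distrib sum_subtractf sum_distrib_left)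

lemmas row_col_linear =
  row_col_add_left row_col_add_right row_col_diff_left row_col_diff_right
  row_col_scale_left row_col_scale_right

lemma vec_star_add: "vec_star (x + y) = vec_star x + vec_star y"
  and vec_star_diff: "vec_star (x - y) = vec_star x - vec_star y"
  and vec_star_scale: "vec_star (a *s x) = cnj a *s vec_star x"
  and vec_star_vec_star [simp]: "vec_star (vec_star x) = x"
  by (simp_all add: vec_star_def vec_eq_iff)

lemmas vec_star_linear = vec_star_add vec_star_diff vec_star_scale

lemma cnj_row_col: "cnj (row_col x y) = row_col (vec_star x) (vec_star y)"
  by (simp add: row_col_def vec_star_def)

lemma row_col_vec_star_self:
  fixes x :: "complex ^ 'n"
  shows "row_col x (vec_star x) = of_real ((norm x)\<^sup>2)"
    and "row_col (vec_star x) x = of_real ((norm x)\<^sup>2)"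
proof -
  have "(norm x)\<^sup>2 = (\<Sum>i\<in>UNIV. (cmod (x $ i))\<^sup>2)"
    by (simp add: norm_vec_def L2_set_def sum_nonneg)
  then show "row_col x (vec_star x) = of_real ((norm x)\<^sup>2)"
    by (simp add: row_col_def vec_star_def complex_norm_square del: of_real_power)
  then show "row_col (vec_star x) x = of_real ((norm x)\<^sup>2)"
    by (simp add: row_col_commute)
qed

lemma norm_vec_star [simp]: "norm (vec_star x) = norm x"
  by (simp add: norm_vec_def vec_star_def)

lemma row_col_vector_matrix_mult:
  "row_col (x v* A) y = row_col x (A *v y)"
proof -
  have "row_col (x v* A) y = (\<Sum>j\<in>UNIV. \<Sum>i\<in>UNIV. x $ i * A $ i $ j * y $ j)"
    by (simp add: row_col_def vector_matrix_mult_def sum_distrib_left mult_ac)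
  also have "\<dots> = (\<Sum>i\<in>UNIV. \<Sum>j\<in>UNIV. x $ i * A $ i $ j * y $ j)"
    by (rule sum.swap)
  also have "\<dots> = row_col x (A *v y)"
    by (simp add: row_col_def matrix_vector_mult_def sum_distrib_left mult_ac)
  finally show ?thesis .
qed

lemma mat_star_mult_vec: "mat_star A *v x = vec_star (vec_star x v* A)"
  by (simp add: vec_eq_iff mat_star_def vec_star_def matrix_vector_mult_def
      vector_matrix_mult_def mult.commute)

lemma schwarz_pick_identity:
  fixes u y :: "complex ^ 'n" and X :: real
  defines "d \<equiv> X - (norm y)\<^sup>2"
  shows "d * (norm (u - vec_star y))\<^sup>2 + (cmod (row_col (u - vec_star y) y))\<^sup>2
       = (cmod (of_real X - row_col u y))\<^sup>2 - d * (X - (norm u)\<^sup>2)"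
proof -
  have E: "row_col (vec_star y) y = of_real ((norm y)\<^sup>2)"
    "row_col u (vec_star u) = of_real ((norm u)\<^sup>2)"
    by (rule row_col_vec_star_self)+
  have "complex_of_real (d * (norm (u - vec_star y))\<^sup>2 + (cmod (row_col (u - vec_star y) y))\<^sup>2)
      = of_real d * row_col (u - vec_star y) (vec_star (u - vec_star y))
        + row_col (u - vec_star y) y * cnj (row_col (u - vec_star y) y)"
    by (simp only: of_real_add of_real_mult row_col_vec_star_self(1) complex_norm_square)
  also have "\<dots> = (of_real X - row_col u y) * cnj (of_real X - row_col u y)
        - of_real d * (of_real X - of_real ((norm u)\<^sup>2))"
    by (simp add: row_col_linear vec_star_linear cnj_row_col E d_def
        row_col_commute[of "vec_star y" "vec_star u"] del: of_real_power)
      (simp add: algebra_simps power2_eq_square)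
  also have "\<dots> = of_real ((cmod (of_real X - row_col u y))\<^sup>2 - d * (X - (norm u)\<^sup>2))"
    by (simp only: of_real_diff of_real_mult complex_norm_square)
  finally show ?thesis
    by (simp only: of_real_eq_iff)
qed

section \<open>Square roots of rank-one perturbations of the identity\<close>

text \<open>If \<open>B\<close> and \<open>C\<close> commute, then \<open>(B + C)(B - C) = B\<^sup>2 - C\<^sup>2 = 0\<close>, and \<open>B + C\<close> is positive
  definite, hence injective.\<close>

lemma pos_semidef_sqrt_unique:
  fixes B C :: "complex ^ 'n ^ 'n"
  assumes B: "pos_semidef B"
    and C: "\<And>x. x \<noteq> 0 \<Longrightarrow> 0 < row_col (vec_star x) (C *v x)"
    and eq: "B ** B = C ** C" and comm: "B ** C = C ** B"
  shows "B = C"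
proof -
  have "B *v x = C *v x" for x
  proof (rule ccontr)
    assume "B *v x \<noteq> C *v x"
    define z where "z = B *v x - C *v x"
    have "z \<noteq> 0" using \<open>B *v x \<noteq> C *v x\<close> by (simp add: z_def)
    have BB: "B *v (B *v x) = C *v (C *v x)" and BC: "B *v (C *v x) = C *v (B *v x)"
      by (simp_all add: matrix_vector_mul_assoc eq comm)
    have "B *v z + C *v z = 0"
      by (simp add: z_def matrix_vector_mult_diff_distrib BB BC)
    then have "row_col (vec_star z) (B *v z) + row_col (vec_star z) (C *v z) = 0"
      by (simp add: row_col_add_right[symmetric]) (simp add: row_col_def)
    moreover have "0 \<le> row_col (vec_star z) (B *v z)"
      using B by (simp add: pos_semidef_def)
    ultimately show False
      using C[OF \<open>z \<noteq> 0\<close>] by (metis add_nonneg_pos less_irrefl)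
  qed
  then show ?thesis by (simp add: matrix_eq)
qed

text \<open>The Hermitian matrix \<open>I + t y y\<^sup>*\<close>, for a column \<open>y\<close> and a real number \<open>t\<close>.\<close>

definition rank_one_pert :: "complex ^ 'n \<Rightarrow> real \<Rightarrow> complex ^ 'n ^ 'n"
  where "rank_one_pert y t = mat 1 + map_matrix (\<lambda>a. of_real t * a) (col_row y (vec_star y))"

lemma rank_one_pert_mult_vec:
  "rank_one_pert y t *v x = x + (of_real t * row_col (vec_star y) x) *s y"
proof -
  have "map_matrix (\<lambda>a. of_real t * a) (col_row y (vec_star y)) *v x
      = (of_real t * row_col (vec_star y) x) *s y"
    by (simp add: vec_eq_iff matrix_vector_mult_def col_row_def row_col_def map_matrix_def
        sum_distrib_left sum_distrib_right mult_ac)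
  then show ?thesis
    by (simp add: rank_one_pert_def matrix_vector_mult_add_rdistrib)
qed

lemma vec_mult_rank_one_pert:
  "x v* rank_one_pert y t = x + (of_real t * row_col x y) *s vec_star y"
proof -
  have "x v* map_matrix (\<lambda>a. of_real t * a) (col_row y (vec_star y))
      = (of_real t * row_col x y) *s vec_star y"
    by (simp add: vec_eq_iff vector_matrix_mult_def col_row_def row_col_def map_matrix_def
        sum_distrib_left sum_distrib_right mult_ac)
  then show ?thesis
    by (simp add: rank_one_pert_def vector_matrix_mult_add_rdistrib)
qed

lemma rank_one_pert_mult:
  "rank_one_pert y s ** rank_one_pert y t = rank_one_pert y (s + t + s * t * (norm y)\<^sup>2)"
  by (simp add: matrix_eq matrix_vector_mul_assoc[symmetric] rank_one_pert_mult_vec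
      row_col_linear row_col_vec_star_self vec_eq_iff algebra_simps)

lemma rank_one_pert_zero: "rank_one_pert y 0 = mat 1"
  by (simp add: matrix_eq rank_one_pert_mult_vec)

lemma rank_one_pert_pos_def:
  fixes y :: "complex ^ 'n"
  assumes "0 < 1 + t * (norm y)\<^sup>2" and "x \<noteq> 0"
  shows "0 < row_col (vec_star x) (rank_one_pert y t *v x)"
proof -
  define a where "a = row_col (vec_star y) x"
  define q where "q = (norm x)\<^sup>2 + t * (cmod a)\<^sup>2"
  have "row_col (vec_star x) y = cnj a"
    by (simp add: a_def cnj_row_col row_col_commute)
  then have q: "row_col (vec_star x) (rank_one_pert y t *v x) = of_real q"
    by (simp add: rank_one_pert_mult_vec row_col_linear row_col_vec_star_self a_def[symmetric]
        q_def complex_norm_square mult_ac del: of_real_power)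
  \<comment> \<open>The Cauchy-Schwarz inequality bounds the quadratic form from below when \<open>t < 0\<close>.\<close>
  have cs: "(cmod a)\<^sup>2 \<le> (norm x)\<^sup>2 * (norm y)\<^sup>2"
  proof -
    have "cmod a \<le> (\<Sum>i\<in>UNIV. cmod (y $ i) * cmod (x $ i))"
      unfolding a_def row_col_def vec_star_def
      by (rule order_trans[OF norm_sum]) (simp add: norm_mult)
    also have "\<dots> \<le> norm y * norm x"
      using L2_set_mult_ineq[of "\<lambda>i. cmod (y $ i)" "\<lambda>i. cmod (x $ i)" UNIV]
      by (simp add: norm_vec_def)
    finally show ?thesis
      by (metis mult.commute norm_ge_zero power_mono power_mult_distrib)
  qed
  have x: "0 < (norm x)\<^sup>2" using assms by simp
  have "0 < q"
  proof (cases "0 \<le> t")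
    case True
    then show ?thesis using x by (simp add: q_def add_pos_nonneg)
  next
    case False
    have "0 < (norm x)\<^sup>2 * (1 + t * (norm y)\<^sup>2)"
      using x assms(1) by (rule mult_pos_pos)
    also have "\<dots> = (norm x)\<^sup>2 + t * ((norm x)\<^sup>2 * (norm y)\<^sup>2)"
      by (simp add: algebra_simps)
    also have "\<dots> \<le> q"
      unfolding q_def using False cs by (intro add_left_mono mult_left_mono_neg) auto
    finally show ?thesis .
  qed
  then show ?thesis by (simp add: q less_complex_def)
qed

text \<open>The second equation says \<open>(I + \<tau> y y\<^sup>*)\<^sup>2 = I + t y y\<^sup>*\<close> for \<open>e = y\<^sup>*y\<close>, the first that
  \<open>I + \<tau> y y\<^sup>*\<close> is positive definite.\<close>

lemma rank_one_root_parameter: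
  fixes t e :: real
  defines "r \<equiv> sqrt (1 + t * e)"
  defines "\<tau> \<equiv> t / (1 + r)"
  assumes "0 < 1 + t * e"
  shows "1 + \<tau> * e = r" and "\<tau> + \<tau> + \<tau> * \<tau> * e = t"
proof -
  have r: "0 < r" "r * r = 1 + t * e"
    using assms by simp_all
  have t: "t = \<tau> * (1 + r)" using r(1) by (simp add: \<tau>_def)
  have "(1 + r) * (1 + \<tau> * e) = (1 + r) + \<tau> * (1 + r) * e" by (simp add: algebra_simps)
  also have "\<dots> = (1 + r) + t * e" by (simp only: t[symmetric])
  also have "\<dots> = (1 + r) * r" using r(2) by (simp add: algebra_simps)
  finally show \<tau>: "1 + \<tau> * e = r" using r(1) by simp
  have "\<tau> + \<tau> + \<tau> * \<tau> * e = \<tau> * (1 + (1 + \<tau> * e))" by (simp add: algebra_simps)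
  then show "\<tau> + \<tau> + \<tau> * \<tau> * e = t" by (simp only: \<tau> t[symmetric])
qed

lemma mat_sqrt_rank_one_pert:
  fixes y :: "complex ^ 'n"
  assumes "0 < 1 + t * (norm y)\<^sup>2"
  shows "mat_sqrt (rank_one_pert y t)
       = rank_one_pert y (t / (1 + sqrt (1 + t * (norm y)\<^sup>2)))"
proof -
  define r where "r = sqrt (1 + t * (norm y)\<^sup>2)"
  define \<tau> where "\<tau> = t / (1 + r)"
  let ?C = "rank_one_pert y \<tau>"
  have r: "0 < r" using assms by (simp add: r_def)
  have \<tau>: "1 + \<tau> * (norm y)\<^sup>2 = r" and CC: "?C ** ?C = rank_one_pert y t"
    using rank_one_root_parameter[OF assms]
    by (simp_all add: \<tau>_def r_def rank_one_pert_mult)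
  have pd: "0 < row_col (vec_star x) (?C *v x)" if "x \<noteq> 0" for x
    using r \<tau> that by (intro rank_one_pert_pos_def) auto
  have "pos_semidef ?C"
    unfolding pos_semidef_def
  proof
    fix x :: "complex ^ 'n"
    show "0 \<le> row_col (vec_star x) (?C *v x)"
      using pd[of x] by (cases "x = 0") (auto simp: row_col_def)
  qed
  moreover have "B = ?C" if B: "pos_semidef B" "B ** B = rank_one_pert y t" for B
  proof (rule pos_semidef_sqrt_unique[OF B(1) pd])
    show "B ** B = ?C ** ?C" by (simp add: B(2) CC)
    \<comment> \<open>The candidate root is a polynomial in \<open>I + t y y\<^sup>*\<close>, also when \<open>t = 0\<close>.\<close>
    have C: "?C *v x = x + of_real (1 / (1 + r)) *s (rank_one_pert y t *v x - x)" for x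
      by (simp add: rank_one_pert_mult_vec \<tau>_def)
    have "rank_one_pert y t *v (B *v x) = B *v (rank_one_pert y t *v x)" for x
      by (simp add: B(2)[symmetric] matrix_vector_mul_assoc matrix_mul_assoc)
    then show "B ** ?C = ?C ** B"
      by (simp add: matrix_eq matrix_vector_mul_assoc[symmetric] C matrix_vector_right_distrib
          matrix_vector_mult_diff_distrib vector_scalar_commute)
  qed
  ultimately show ?thesis
    unfolding mat_sqrt_def r_def[symmetric] \<tau>_def[symmetric]
    using CC by (intro the_equality) blast+
qed

lemma norm_vec_mult_sqrt_rank_one_pert:
  fixes w y :: "complex ^ 'n"
  assumes "0 < 1 + t * (norm y)\<^sup>2"
  shows "(norm (w v* mat_sqrt (rank_one_pert y t)))\<^sup>2
       = (norm w)\<^sup>2 + t * (cmod (row_col w y))\<^sup>2"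
proof -
  let ?r = "sqrt (1 + t * (norm y)\<^sup>2)"
  let ?\<tau> = "t / (1 + ?r)"
  have CC: "?\<tau> + ?\<tau> + ?\<tau> * ?\<tau> * (norm y)\<^sup>2 = t"
    by (rule rank_one_root_parameter[OF assms])
  define a where "a = row_col w y"
  have a: "row_col (vec_star y) (vec_star w) = cnj a"
    by (simp add: a_def cnj_row_col row_col_commute)
  have norm_sq: "complex_of_real ((norm (w + (of_real \<tau> * a) *s vec_star y))\<^sup>2)
      = of_real ((norm w)\<^sup>2 + (\<tau> + \<tau> + \<tau> * \<tau> * (norm y)\<^sup>2) * (cmod a)\<^sup>2)" for \<tau> :: real
    unfolding of_real_add of_real_mult complex_norm_square row_col_vec_star_self(1)[symmetric]
    by (simp add: row_col_linear vec_star_linear a a_def[symmetric]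
        row_col_vec_star_self algebra_simps)
  show ?thesis
    using norm_sq[of ?\<tau>]
    unfolding mat_sqrt_rank_one_pert[OF assms] vec_mult_rank_one_pert a_def[symmetric] CC
    by (simp only: of_real_eq_iff)
qed

section \<open>The norm of the Blaschke factor\<close>

lemma matrix_inv_eqI:
  fixes A B :: "'a::field ^ 'n ^ 'n"
  assumes "A ** B = mat 1"
  shows "matrix_inv A = B"
proof -
  have BA: "B ** A = mat 1" using assms by (simp add: matrix_left_right_inverse)
  with assms have inv: "A ** matrix_inv A = mat 1"
    unfolding matrix_inv_def
    by (rule someI2[of "\<lambda>A'. A ** A' = mat 1 \<and> A' ** A = mat 1", OF conjI, THEN conjunct1])
  have "matrix_inv A = (B ** A) ** matrix_inv A" by (simp add: BA)
  also have "\<dots> = B" by (simp add: matrix_mul_assoc[symmetric] inv)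
  finally show ?thesis .
qed

text \<open>The matrix \<open>I - y y\<^sup>*\<close> has inverse \<open>I + y y\<^sup>* / (1 - y\<^sup>*y)\<close>, and the roots of the two are
  inverse to each other.\<close>

lemma matrix_inv_sqrt_rank_one_pert:
  fixes y :: "complex ^ 'n"
  assumes "norm y < 1"
  shows "matrix_inv (mat_sqrt (rank_one_pert y (- 1)))
       = mat_sqrt (rank_one_pert y (1 / (1 - (norm y)\<^sup>2)))"
proof -
  define E where "E = (norm y)\<^sup>2"
  define r where "r = sqrt (1 - E)"
  have E: "0 < 1 - E" using assms by (simp add: E_def abs_square_less_1)
  have r: "0 < r" "r * r = 1 - E" using E by (simp_all add: r_def)
  have E': "1 + 1 / (1 - E) * E = 1 / (1 - E)" using E by (simp add: field_simps)
  have root1: "mat_sqrt (rank_one_pert y (- 1)) = rank_one_pert y (- 1 / (1 + r))"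
    using mat_sqrt_rank_one_pert[of "- 1" y] E by (simp add: E_def r_def)
  have root2: "mat_sqrt (rank_one_pert y (1 / (1 - E))) = rank_one_pert y (1 / (r * (1 + r)))"
  proof -
    have "1 / (1 - E) / (1 + sqrt (1 / (1 - E))) = 1 / (r * r) / (1 + 1 / r)"
      by (simp add: r_def[symmetric] r(2) real_sqrt_divide)
    also have "\<dots> = 1 / (r * (1 + r))" using r(1) by (simp add: field_simps)
    finally show ?thesis
      using mat_sqrt_rank_one_pert[of "1 / (1 - E)" y] E E' by (simp add: E_def)
  qed
  have "E = (1 - r) * (1 + r)" using r(2) by (simp add: algebra_simps)
  moreover define p q where "p = - 1 / (1 + r)" and "q = 1 / (r * (1 + r))"
  ultimately have pE: "p * E = r - 1" and p: "p = - r * q"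
    using r(1) by simp_all
  have "p + q + p * q * E = p + q + (p * E) * q" by simp
  also have "\<dots> = p + q + (r - 1) * q" by (simp only: pE)
  also have "\<dots> = 0" by (simp add: p algebra_simps)
  finally show ?thesis
    unfolding E_def[symmetric] root1 root2 p_def[symmetric] q_def[symmetric]
    by (intro matrix_inv_eqI) (simp add: rank_one_pert_mult rank_one_pert_zero E_def)
qed

lemma norm_blaschke:
  fixes \<nu> l :: "complex ^ 'n"
  assumes \<nu>: "norm \<nu> < 1" and l: "norm l < 1"
  shows "(norm (blaschke \<nu> l))\<^sup>2
       = 1 - (1 - (norm \<nu>)\<^sup>2) * (1 - (norm l)\<^sup>2) / (cmod (1 - row_inner l \<nu>))\<^sup>2"
proof -
  define E where "E = (norm \<nu>)\<^sup>2"
  define w where "w = l - \<nu>"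
  define k where "k = cmod (1 - row_inner l \<nu>)"
  define D where "D = mat_sqrt (rank_one_pert (vec_star \<nu>) (1 / (1 - E)))"
  have E: "0 < 1 - E" using \<nu> by (simp add: E_def abs_square_less_1)
  have l1: "0 < 1 - (norm l)\<^sup>2" using l by (simp add: abs_square_less_1)
  have pert: "mat 1 - col_row (vec_star \<nu>) \<nu> = rank_one_pert (vec_star \<nu>) (- 1)"
    by (simp add: rank_one_pert_def vec_eq_iff map_matrix_def)
  have inv: "matrix_inv (mat_sqrt (mat 1 - col_row (vec_star \<nu>) \<nu>)) = D"
    using matrix_inv_sqrt_rank_one_pert[of "vec_star \<nu>"] \<nu> by (simp add: pert D_def E_def)
  have "1 + 1 / (1 - E) * E = 1 / (1 - E)" using E by (simp add: field_simps)
  then have wD: "(norm (w v* D))\<^sup>2 = (norm w)\<^sup>2 + (cmod (row_col w (vec_star \<nu>)))\<^sup>2 / (1 - E)"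
    using E norm_vec_mult_sqrt_rank_one_pert[of "1 / (1 - E)" "vec_star \<nu>" w]
    by (simp add: D_def E_def)
  have id: "(1 - E) * (norm w)\<^sup>2 + (cmod (row_col w (vec_star \<nu>)))\<^sup>2
      = k\<^sup>2 - (1 - E) * (1 - (norm l)\<^sup>2)"
    using schwarz_pick_identity[of 1 "vec_star \<nu>" l]
    by (simp add: w_def E_def k_def row_inner_def)
  \<comment> \<open>The identity also gives \<open>\<langle>l,\<nu>\<rangle> \<noteq> 1\<close>: for \<open>k = 0\<close> its right-hand side would be negative.\<close>
  have "k \<noteq> 0"
  proof
    assume "k = 0"
    have "0 \<le> (1 - E) * (norm w)\<^sup>2 + (cmod (row_col w (vec_star \<nu>)))\<^sup>2"
      using E by simp
    then show False using id \<open>k = 0\<close> mult_pos_pos[OF E l1] by simp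
  qed
  have smult: "norm (a *s x) = cmod a * norm x" for a :: complex and x :: "complex ^ 'n"
    by (simp add: norm_vec_def norm_mult L2_set_right_distrib)
  have "1 - row_inner \<nu> \<nu> = of_real (1 - E)"
    by (simp add: row_inner_def row_col_vec_star_self E_def)
  then have "csqrt (1 - row_inner \<nu> \<nu>) = of_real (sqrt (1 - E))"
    using E by (simp only: csqrt_of_real less_imp_le)
  then have "(norm (blaschke \<nu> l))\<^sup>2 = (1 - E) / k\<^sup>2 * (norm (w v* D))\<^sup>2"
    using E by (simp add: blaschke_def inv smult w_def[symmetric] k_def norm_divide
        power_mult_distrib power_divide)
  also have "\<dots> = ((1 - E) * (norm w)\<^sup>2 + (cmod (row_col w (vec_star \<nu>)))\<^sup>2) / k\<^sup>2"
    using E \<open>k \<noteq> 0\<close> by (simp add: wD field_simps)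
  also have "\<dots> = 1 - (1 - E) * (1 - (norm l)\<^sup>2) / k\<^sup>2"
    using \<open>k \<noteq> 0\<close> by (simp add: id diff_divide_distrib)
  finally show ?thesis by (simp add: E_def k_def)
qed

section \<open>The two-point inequality\<close>

lemma row_col_map_matrix_divide:
  "row_col x (map_matrix (\<lambda>a. a / k) A *v y) = row_col x (A *v y) / k"
proof -
  have "map_matrix (\<lambda>a. a / k) A *v y = (1 / k) *s (A *v y)"
    by (simp add: vec_eq_iff matrix_vector_mult_def map_matrix_def sum_divide_distrib)
  then show ?thesis by (simp add: row_col_linear)
qed

text \<open>The two-by-two matrix of the kernel, compressed to \<open>\<xi>\<close>, at the points \<open>l\<close> and \<open>\<nu>\<close> has a
  nonnegative determinant; the denominators are cleared.\<close>

lemma schur_multiplier_two_point: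
  fixes s :: "complex ^ 'n \<Rightarrow> complex ^ 'q ^ 'p" and \<xi> :: "complex ^ 'p"
  assumes s: "schur_multiplier s" and \<nu>: "norm \<nu> < 1" and l: "norm l < 1"
    and pos: "(norm (vec_star \<xi> v* s \<nu>))\<^sup>2 < (norm \<xi>)\<^sup>2"
  shows "(cmod (of_real ((norm \<xi>)\<^sup>2) - row_col (vec_star \<xi> v* s l) (vec_star (vec_star \<xi> v* s \<nu>))))\<^sup>2
      * ((1 - (norm \<nu>)\<^sup>2) * (1 - (norm l)\<^sup>2) / (cmod (1 - row_inner l \<nu>))\<^sup>2)
    \<le> ((norm \<xi>)\<^sup>2 - (norm (vec_star \<xi> v* s l))\<^sup>2) * ((norm \<xi>)\<^sup>2 - (norm (vec_star \<xi> v* s \<nu>))\<^sup>2)"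
proof -
  define u where "u m = vec_star \<xi> v* s m" for m
  define k where
    "k m n = (of_real ((norm \<xi>)\<^sup>2) - row_col (u m) (vec_star (u n))) / (1 - row_inner m n)" for m n
  define A where "A = ((norm \<xi>)\<^sup>2 - (norm (u l))\<^sup>2) / (1 - (norm l)\<^sup>2)"
  define B where "B = ((norm \<xi>)\<^sup>2 - (norm (u \<nu>))\<^sup>2) / (1 - (norm \<nu>)\<^sup>2)"
  define C where "C = k l \<nu>"
  have l1: "0 < 1 - (norm l)\<^sup>2" and \<nu>1: "0 < 1 - (norm \<nu>)\<^sup>2"
    using l \<nu> by (simp_all add: abs_square_less_1)
  have "0 < B" using pos \<nu>1 by (simp add: B_def u_def)
  have kll: "k l l = of_real A" and k\<nu>\<nu>: "k \<nu> \<nu> = of_real B"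
    by (simp_all add: k_def A_def B_def row_col_vec_star_self row_inner_def)
  have k\<nu>l: "k \<nu> l = cnj C"
    by (simp add: C_def k_def row_inner_def cnj_row_col row_col_commute)
  have compress: "row_col (vec_star (a *s \<xi>))
      (map_matrix (\<lambda>a. a / (1 - row_inner m n)) (mat 1 - s m ** mat_star (s n)) *v (b *s \<xi>))
      = cnj a * b * k m n" for a b m n
  proof -
    have "row_col (vec_star \<xi>) ((mat 1 - s m ** mat_star (s n)) *v \<xi>)
        = of_real ((norm \<xi>)\<^sup>2) - row_col (u m) (vec_star (u n))"
      by (simp add: matrix_vector_mult_diff_rdistrib matrix_vector_mul_assoc[symmetric]
          row_col_linear mat_star_mult_vec row_col_vector_matrix_mult row_col_vec_star_self u_def)
    then show ?thesis
      by (simp add: row_col_map_matrix_divide vec_star_linear row_col_linear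
          vector_scalar_commute k_def del: of_real_power)
  qed
  \<comment> \<open>The vector \<open>(B, - cnj C)\<close> turns the form with matrix \<open>A, C, cnj C, B\<close> into \<open>B\<close> times the
    determinant.\<close>
  define z where "z i = (if i = 0 then l else \<nu>)" for i :: nat
  define v where "v i = (if i = 0 then of_real B else - cnj C) *s \<xi>" for i :: nat
  have z: "\<forall>i<2. z i \<in> ball 0 1" using l \<nu> by (simp add: z_def)
  have "0 \<le> (\<Sum>i<2. \<Sum>j<2. row_col (vec_star (v i))
      (map_matrix (\<lambda>a. a / (1 - row_inner (z i) (z j)))
        (mat 1 - s (z i) ** mat_star (s (z j))) *v v j))"
    using s z unfolding schur_multiplier_def pos_kernel_on_def by blast
  also have "\<dots> = of_real (B * (A * B - (cmod C)\<^sup>2))"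
    unfolding v_def compress of_real_mult of_real_diff complex_norm_square
    by (simp add: numeral_2_eq_2 z_def kll k\<nu>\<nu> k\<nu>l C_def[symmetric] algebra_simps)
  finally have "0 \<le> B * (A * B - (cmod C)\<^sup>2)"
    by (simp only: less_eq_complex_def Re_complex_of_real zero_complex.sel)
  with \<open>0 < B\<close> have "(cmod C)\<^sup>2 \<le> A * B"
    by (simp add: zero_le_mult_iff)
  then have "(cmod C)\<^sup>2 * ((1 - (norm \<nu>)\<^sup>2) * (1 - (norm l)\<^sup>2))
      \<le> A * B * ((1 - (norm \<nu>)\<^sup>2) * (1 - (norm l)\<^sup>2))"
    using l1 \<nu>1 by (intro mult_right_mono) auto
  also have "\<dots> = ((norm \<xi>)\<^sup>2 - (norm (u l))\<^sup>2) * ((norm \<xi>)\<^sup>2 - (norm (u \<nu>))\<^sup>2)"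
    using l1 \<nu>1 by (simp add: A_def B_def)
  finally show ?thesis
    by (simp add: C_def k_def u_def norm_divide power_divide)
qed

section \<open>The interpolation estimate\<close>

theorem theorem3:
  fixes s :: "complex ^ 'N \<Rightarrow> complex ^ 'q ^ 'p"
    and \<nu> l :: "complex ^ 'N"
    and \<xi> :: "complex ^ 'p"
    and \<eta> :: "complex ^ 'q"
    and c :: "complex ^ ('p + 'q)"
  assumes "schur_multiplier s"
    and "\<nu> \<in> ball 0 1"
    and "row_col (vec_star \<eta>) \<eta> < row_col (vec_star \<xi>) \<xi>"
    and "vec_star \<xi> v* s \<nu> = vec_star \<eta>"
    and "c = stack \<xi> \<eta>"
    and "l \<in> ball 0 1"
  shows "norm ((vec_star \<xi> v* s l - vec_star \<eta>) v*
            mat_sqrt (mat 1 + map_matrix (\<lambda>a. a / row_col (vec_star c) (J_mat *v c))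
                                (col_row \<eta> (vec_star \<eta>))))
       \<le> cmod (row_col (vec_star \<xi>) \<xi> - row_col (vec_star \<xi> v* s l) \<eta>)
            / sqrt (Re (row_col (vec_star c) (J_mat *v c)))
          * norm (blaschke \<nu> l)"
proof -
  define u where "u = vec_star \<xi> v* s l"
  define X where "X = (norm \<xi>)\<^sup>2"
  define d where "d = X - (norm \<eta>)\<^sup>2"
  define b where "b = (norm (blaschke \<nu> l))\<^sup>2"
  define w where "w = u - vec_star \<eta>"
  define M where "M = (cmod (of_real X - row_col u \<eta>))\<^sup>2"
  have \<nu>: "norm \<nu> < 1" and l: "norm l < 1"
    using assms(2,6) by simp_all
  have d: "0 < d"
    using assms(3) by (simp add: row_col_vec_star_self d_def X_def less_complex_def)
  have cJc: "row_col (vec_star c) (J_mat *v c) = of_real d"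
    by (simp add: assms(5) stack_J_stack row_col_vec_star_self d_def X_def)
  have pert: "mat 1 + map_matrix (\<lambda>a. a / of_real d) (col_row \<eta> (vec_star \<eta>))
      = rank_one_pert \<eta> (1 / d)"
    by (simp add: rank_one_pert_def vec_eq_iff map_matrix_def)
  have lhs: "(norm (w v* mat_sqrt (rank_one_pert \<eta> (1 / d))))\<^sup>2
      = (d * (norm w)\<^sup>2 + (cmod (row_col w \<eta>))\<^sup>2) / d"
    using d norm_vec_mult_sqrt_rank_one_pert[of "1 / d" \<eta> w]
    by (simp add: add_pos_nonneg add_divide_distrib)
  have "d * (norm w)\<^sup>2 + (cmod (row_col w \<eta>))\<^sup>2 = M - d * (X - (norm u)\<^sup>2)"
    using schwarz_pick_identity[of X \<eta> u] by (simp add: w_def d_def M_def)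
  also have "\<dots> \<le> M * b"
  proof -
    have "M * (1 - b) \<le> (X - (norm u)\<^sup>2) * d"
      using schur_multiplier_two_point[OF assms(1) \<nu> l, of \<xi>] d
      by (simp add: b_def norm_blaschke[OF \<nu> l] assms(4) M_def X_def u_def d_def)
    then show ?thesis by (simp add: algebra_simps)
  qed
  finally have "(norm (w v* mat_sqrt (rank_one_pert \<eta> (1 / d))))\<^sup>2 \<le> M * b / d"
    unfolding lhs using d by (simp add: divide_right_mono)
  also have "\<dots> = (cmod (of_real X - row_col u \<eta>) / sqrt d * norm (blaschke \<nu> l))\<^sup>2"
    using d by (simp add: M_def b_def power_mult_distrib power_divide)
  finally have "norm (w v* mat_sqrt (rank_one_pert \<eta> (1 / d)))
      \<le> cmod (of_real X - row_col u \<eta>) / sqrt d * norm (blaschke \<nu> l)"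
    by (rule power2_le_imp_le) (use d in simp)
  then show ?thesis
    by (simp add: cJc pert w_def u_def X_def row_col_vec_star_self)
qed

end
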